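(* If $P$ is a lexicographically nested-shellable poset, then the order complex $\Delta(P)$ is nested-shellable.
   Context: In a poset $P$: $q$ covers $p$ (written $p\lessdot q$) if $p<q$ and there is no $p'$ with $p<p'<q$; $C(P)$ is the set of pairs $(p,q)$ with $p\lessdot q$. The interval $[p,q]=\{r\in P: p\le r\le q\}$. A chain is a totally ordered subset; a chain is saturated if whenever $p,q$ are in it and $p<p'<q$ then $p'$ is in it; a chain is discrete-saturated if it is saturated and of the form $p_0<p_1<\cdots$ (finite or order-isomorphic to $\mathbb N$), equivalently $p_i\lessdot p_{i+1}$ for all $i$. An edge-labeling of $P$ with values in a poset $Q$ is a function $\lambda:C(P)\to Q$; the Jordan-Hölder sequence of a discrete-saturated chain $p_0\lessdot p_1\lessdot\cdots$ is $(\lambda(p_0,p_1),\lambda(p_1,p_2),\dots)$, and the chain is $\lambda$-increasing if $\lambda(p_0,p_1)<\lambda(p_1,p_2)<\cdots$. A graded poset is a finite poset with a unique minimal and a unique maximal element in which all maximal chains have the same size. An edge-labeling $\lambda$ of a graded poset is an $L$-labeling if for every $p<q$ (L1) there is a unique $\lambda$-increasing maximal chain $C$ in $[p,q]$, and (L2) the Jordan-Hölder sequence of $C$ lexicographically precedes that of every other maximal chain in $[p,q]$. A poset $P$ is $\mathbb N$-graded if (G1) it has a unique minimal element $\hat0$, (G2) for every $p$ there is a finite saturated chain from $\hat0$ to $p$, and (G3) for every $p$ all maximal chains in $[\hat0,p]$ have the same length. $P$ is interval-finite if every interval $[p,p']$ is finite. $P$ is lexicographically nested-shellable if it is interval-finite,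 $\mathbb N$-graded, and (LNS1) there is an edge-labeling $\lambda$ of $P$ which restricts to an $L$-labeling of the (graded) poset $[p,q]$ for every $p\le q$, and (LNS2) there is a chain $\hat0<p_1<p_2<\cdots$ such that every $p\in P$ satisfies $p\le p_n$ for some $n$. The order complex $\Delta(P)$ is the simplicial complex with vertex set $P$ whose faces are the finite chains of $P$. A simplicial complex (collection of finite subsets of a countable vertex set closed under subsets) $\Delta$ is nested-shellable if there is an increasing sequence $\Delta_1\subseteq\Delta_2\subseteq\cdots$ of finite full subcomplexes (a subcomplex $\Delta'$ is full if every face of $\Delta$ all of whose vertices are vertices of $\Delta'$ lies in $\Delta'$), each of which is shellable (a finite pure complex whose facets can be ordered $F_1,\dots,F_m$ so that for $i\ge2$, $\langle F_i\rangle\cap\langle F_1,\dots,F_{i-1}\rangle$ is generated by a non-empty set of maximal proper faces of $\langle F_i\rangle$), with $\bigcup_n\Delta_n=\Delta$. *)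

theory Defs
  imports Main "HOL-Library.Countable_Set"
begin

text \<open>
  A poset is a set \<open>P\<close> in a type of class \<open>order\<close>, carrying the order of the type. This loses no
  generality and turns intervals of \<open>P\<close> into posets of the same kind. Chains are those of
  \<^locale>\<open>pred_on\<close>, so \<open>pred_on.maxchain P (<)\<close> says that a set is a maximal chain of \<open>P\<close>.
\<close>

definition covers :: "'a::order set \<Rightarrow> 'a \<Rightarrow> 'a \<Rightarrow> bool" where
  "covers P p q \<longleftrightarrow> p \<in> P \<and> q \<in> P \<and> p < q \<and> \<not> (\<exists>r\<in>P. p < r \<and> r < q)"

definition interval :: "'a::order set \<Rightarrow> 'a \<Rightarrow> 'a \<Rightarrow> 'a set" where
  "interval P p q = {r \<in> P. p \<le> r \<and> r \<le> q}"

definition is_minimal :: "'a::order set \<Rightarrow> 'a \<Rightarrow> bool" where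
  "is_minimal P m \<longleftrightarrow> m \<in> P \<and> \<not> (\<exists>x\<in>P. x < m)"

definition is_maximal :: "'a::order set \<Rightarrow> 'a \<Rightarrow> bool" where
  "is_maximal P m \<longleftrightarrow> m \<in> P \<and> \<not> (\<exists>x\<in>P. m < x)"

definition graded_poset :: "'a::order set \<Rightarrow> bool" where
  "graded_poset P \<longleftrightarrow> finite P \<and> (\<exists>!m. is_minimal P m) \<and> (\<exists>!m. is_maximal P m) \<and>
     (\<forall>C D. pred_on.maxchain P (<) C \<and> pred_on.maxchain P (<) D \<longrightarrow> card C = card D)"

text \<open>
  An edge-labeling is a function of the two ends of an edge. Its values on pairs that are not covers
  are irrelevant: in \<open>L_labeling\<close> below it is evaluated only at consecutive elements of maximal
  chains of intervals, and these cover each other in the interval and hence in the whole poset.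
  Finite maximal chains are represented by their strictly increasing lists of elements.
\<close>

definition maximal_chain_list :: "'a::order set \<Rightarrow> 'a list \<Rightarrow> bool" where
  "maximal_chain_list P xs \<longleftrightarrow> sorted_wrt (<) xs \<and> pred_on.maxchain P (<) (set xs)"

definition JH_sequence :: "('a \<Rightarrow> 'a \<Rightarrow> 'q) \<Rightarrow> 'a list \<Rightarrow> 'q list" where
  "JH_sequence lam xs = map2 lam (butlast xs) (tl xs)"

definition increasing_chain :: "('a \<Rightarrow> 'a \<Rightarrow> 'q::order) \<Rightarrow> 'a list \<Rightarrow> bool" where
  "increasing_chain lam xs \<longleftrightarrow> sorted_wrt (<) (JH_sequence lam xs)"

definition lex_precedes :: "'q::order list \<Rightarrow> 'q list \<Rightarrow> bool" where
  "lex_precedes as bs \<longleftrightarrow> (as, bs) \<in> lexord {(a, b). a < b}"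

definition L_labeling :: "'a::order set \<Rightarrow> ('a \<Rightarrow> 'a \<Rightarrow> 'q::order) \<Rightarrow> bool" where
  "L_labeling P lam \<longleftrightarrow> graded_poset P \<and>
     (\<forall>p\<in>P. \<forall>q\<in>P. p < q \<longrightarrow>
        (\<exists>!xs. maximal_chain_list (interval P p q) xs \<and> increasing_chain lam xs) \<and>
        (\<forall>xs ys. maximal_chain_list (interval P p q) xs \<and> increasing_chain lam xs \<and>
           maximal_chain_list (interval P p q) ys \<and> ys \<noteq> xs \<longrightarrow>
           lex_precedes (JH_sequence lam xs) (JH_sequence lam ys)))"

text \<open>Meaningful only if \<open>P\<close> has a unique minimal element.\<close>

definition zero_hat :: "'a::order set \<Rightarrow> 'a" where
  "zero_hat P = (THE m. is_minimal P m)"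

text \<open>
  The second condition provides a finite maximal chain in each \<open>[0, p]\<close>. As \<open>card\<close> is \<open>0\<close> on infinite
  sets, the third condition thus also excludes infinite maximal chains in \<open>[0, p]\<close>.
\<close>

definition N_graded :: "'a::order set \<Rightarrow> bool" where
  "N_graded P \<longleftrightarrow> (\<exists>!m. is_minimal P m) \<and>
     (\<forall>p\<in>P. \<exists>xs. xs \<noteq> [] \<and> set xs \<subseteq> P \<and> successively (covers P) xs \<and>
        hd xs = zero_hat P \<and> last xs = p) \<and>
     (\<forall>p\<in>P. \<forall>C D. pred_on.maxchain (interval P (zero_hat P) p) (<) C \<and>
        pred_on.maxchain (interval P (zero_hat P) p) (<) D \<longrightarrow> card C = card D)"

definition interval_finite :: "'a::order set \<Rightarrow> bool" where
  "interval_finite P \<longleftrightarrow> (\<forall>p\<in>P. \<forall>q\<in>P. finite (interval P p q))"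

text \<open>
  The type argument \<open>Q\<close> is the poset of labels: a definition cannot quantify existentially over
  types, so the choice of label poset becomes a type parameter. In the last condition the chain
  \<open>0 < p 1 < p 2 < \<dots>\<close> may be finite or infinite; a finite \<open>P\<close> has only finite ones.
\<close>

definition lex_nested_shellable :: "'q::order itself \<Rightarrow> 'a::order set \<Rightarrow> bool" where
  "lex_nested_shellable Q P \<longleftrightarrow> interval_finite P \<and> N_graded P \<and>
     (\<exists>lam :: 'a \<Rightarrow> 'a \<Rightarrow> 'q. \<forall>p\<in>P. \<forall>q\<in>P. p \<le> q \<longrightarrow> L_labeling (interval P p q) lam) \<and>
     (\<exists>(I :: nat set) c. (I = UNIV \<or> (\<exists>n. I = {..n})) \<and> strict_mono_on I c \<and> c ` I \<subseteq> P \<and>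
        c 0 = zero_hat P \<and> (\<forall>p\<in>P. \<exists>i\<in>I. p \<le> c i))"

definition abstract_simplicial_complex :: "'v set set \<Rightarrow> bool" where
  "abstract_simplicial_complex K \<longleftrightarrow>
     countable (\<Union>K) \<and> (\<forall>F\<in>K. finite F) \<and> (\<forall>F\<in>K. \<forall>G. G \<subseteq> F \<longrightarrow> G \<in> K)"

definition full_subcomplex :: "'v set set \<Rightarrow> 'v set set \<Rightarrow> bool" where
  "full_subcomplex L K \<longleftrightarrow> abstract_simplicial_complex L \<and> L \<subseteq> K \<and>
     (\<forall>F\<in>K. F \<subseteq> \<Union>L \<longrightarrow> F \<in> L)"

definition facets :: "'v set set \<Rightarrow> 'v set set" where
  "facets K = {F \<in> K. \<not> (\<exists>G\<in>K. F \<subset> G)}"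

definition pure_complex :: "'v set set \<Rightarrow> bool" where
  "pure_complex K \<longleftrightarrow> (\<forall>F\<in>facets K. \<forall>G\<in>facets K. card F = card G)"

definition generated_complex :: "'v set set \<Rightarrow> 'v set set" where
  "generated_complex S = (\<Union>F\<in>S. Pow F)"

definition maximal_proper_faces :: "'v set \<Rightarrow> 'v set set" where
  "maximal_proper_faces F = {G. G \<subset> F \<and> \<not> (\<exists>H. G \<subset> H \<and> H \<subset> F)}"

definition shellable :: "'v set set \<Rightarrow> bool" where
  "shellable K \<longleftrightarrow> abstract_simplicial_complex K \<and> finite K \<and> pure_complex K \<and>
     (\<exists>Fs. distinct Fs \<and> set Fs = facets K \<and>
        (\<forall>i. 0 < i \<and> i < length Fs \<longrightarrow>
           (\<exists>S. S \<noteq> {} \<and> S \<subseteq> maximal_proper_faces (Fs ! i) \<and>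
              generated_complex {Fs ! i} \<inter> generated_complex (set (take i Fs))
                = generated_complex S)))"

definition nested_shellable :: "'v set set \<Rightarrow> bool" where
  "nested_shellable K \<longleftrightarrow> abstract_simplicial_complex K \<and>
     (\<exists>L :: nat \<Rightarrow> 'v set set. (\<forall>n. L n \<subseteq> L (Suc n)) \<and>
        (\<forall>n. full_subcomplex (L n) K \<and> finite (L n) \<and> shellable (L n)) \<and> (\<Union>n. L n) = K)"

definition order_complex :: "'a::order set \<Rightarrow> 'a set set" where
  "order_complex P = {C. finite C \<and> pred_on.chain P (<) C}"

end

theory Submission
  imports Defs
begin

text \<open>
  Bjorner's argument shows that an \<open>L\<close>-labeling shells the order complex of a graded poset: list the
  maximal chains along a linear extension of the lexicographic order of their Jordan-Holder sequences
  (labels are only partially ordered). If \<open>ys\<close> comes before \<open>xs\<close>, then on the first interval where the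
  two differ, \<open>xs\<close> is not increasing, for otherwise it would lexicographically precede \<open>ys\<close>. At a
  descent \<open>e\<close> of \<open>xs\<close> in that interval, exchange \<open>e\<close> for the middle element of the increasing chain of
  the surrounding interval of length two. This gives an earlier chain that meets \<open>xs\<close> in \<open>xs - {e}\<close>,
  a set containing \<open>xs \<inter> ys\<close>. For the infinite poset, the order complexes of the intervals from the
  minimum to the members of the cofinal chain exhaust the order complex.
\<close>

section \<open>Linear extensions, and finite chains as sorted lists\<close>

lemma ex_linear_extension_list:
  fixes R :: "'b \<Rightarrow> 'b \<Rightarrow> bool"
  assumes "finite A" "asymp_on A R" "transp_on A R"
  shows "\<exists>xs. distinct xs \<and> set xs = A \<and> sorted_wrt (\<lambda>x y. \<not> R y x) xs"
  using assms
proof (induction "card A" arbitrary: A)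
  case 0
  then show ?case by auto
next
  case (Suc n)
  then have "A \<noteq> {}" by auto
  \<comment> \<open>An \<open>R\<close>-minimal element may head the list: no later entry is
    \<open>R\<close>-below it.\<close>
  then obtain m where m: "m \<in> A" "\<forall>x\<in>A. x \<noteq> m \<longrightarrow> \<not> R x m"
    using Finite_Set.bex_min_element[of A R] Suc.prems by blast
  have "n = card (A - {m})" using Suc.hyps(2) Suc.prems m by simp
  moreover have "asymp_on (A - {m}) R" "transp_on (A - {m}) R"
    using Suc.prems by (auto intro: asymp_on_subset transp_on_subset)
  ultimately obtain xs where "distinct xs" "set xs = A - {m}" "sorted_wrt (\<lambda>x y. \<not> R y x) xs"
    using Suc.hyps(1)[of "A - {m}"] Suc.prems by auto
  then show ?case
    using m by (intro exI[of _ "m # xs"]) auto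
qed

lemma chain_iff:
  "pred_on.chain A (<) C \<longleftrightarrow> C \<subseteq> A \<and> (\<forall>x\<in>C. \<forall>y\<in>C. x \<le> y \<or> y \<le> (x::'a::order))"
  unfolding pred_on.chain_def by (auto simp: le_less)

text \<open>In a linear extension of \<open><\<close> no entry exceeds a later one. Comparability
  within a chain and distinctness turn this into strict increase.\<close>

lemma ex_sorted_list_of_finite_chain:
  assumes "finite C" "pred_on.chain A (<) (C :: 'a::order set)"
  shows "\<exists>xs. sorted_wrt (<) xs \<and> set xs = C"
proof -
  obtain xs where xs: "distinct xs" "set xs = C" "sorted_wrt (\<lambda>x y. \<not> y < x) xs"
    using ex_linear_extension_list[OF assms(1) asymp_on_less transp_on_less] by blast
  have "sorted_wrt (\<lambda>x y. x \<noteq> y) xs"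
    using xs(1) by (simp add: distinct_conv_nth sorted_wrt_iff_nth_less)
  then have "sorted_wrt (\<lambda>x y. \<not> y < x \<and> x \<noteq> y) xs"
    using xs(3) by (auto simp: sorted_wrt_iff_nth_less)
  then have "sorted_wrt (<) xs"
    by (rule sorted_wrt_mono_rel[rotated])
       (use assms(2) xs(2) in \<open>auto simp: chain_iff le_less\<close>)
  then show ?thesis using xs(2) by blast
qed

text \<open>The head of a strictly increasing list is the least element of its set, so the set
  determines the list entry by entry. Hence lists can stand for facets without repetition.\<close>

lemma sorted_wrt_less_set_inj:
  assumes "sorted_wrt (<) xs" "sorted_wrt (<) ys" "set xs = set (ys :: 'a::order list)"
  shows "xs = ys"
  using assms
proof (induction xs arbitrary: ys)
  case Nil
  then show ?case by simp
next
  case (Cons x xs)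
  then obtain y ys' where ys: "ys = y # ys'" by (cases ys) auto
  have xy: "x = y"
    using Cons.prems unfolding ys by (metis insert_iff less_asym list.simps(15) sorted_wrt.simps(2))
  have "x \<notin> set xs" "y \<notin> set ys'"
    using Cons.prems unfolding ys by auto
  then have "set xs = set ys'" using Cons.prems xy unfolding ys by auto
  then show ?case using Cons xy unfolding ys by auto
qed

lemma sorted_wrt_less_distinct: "sorted_wrt (<) xs \<Longrightarrow> distinct (xs :: 'a::order list)"
  by (induction xs) auto

section \<open>Maximal chains of intervals as saturated chains\<close>

lemma successivelyI_split:
  assumes "\<And>as x y bs. xs = as @ x # y # bs \<Longrightarrow> P x y"
  shows "successively P xs"
  using assms
proof (induction xs rule: induct_list012)
  case (3 x y zs)
  have "P x y" by (rule 3(3)[of "[]"]) simp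
  moreover have "successively P (y # zs)"
    by (rule 3(2), rule 3(3)[of "x # _"]) simp
  ultimately show ?case by simp
qed auto

text \<open>Covers are taken in all of \<open>K\<close>, not in the interval from \<open>p\<close>
  to \<open>q\<close>, so that chains can be cut and spliced without changing the ambient
  poset.\<close>

definition saturated_from_to :: "'a::order set \<Rightarrow> 'a \<Rightarrow> 'a \<Rightarrow> 'a list \<Rightarrow> bool" where
  "saturated_from_to K p q xs \<longleftrightarrow>
     xs \<noteq> [] \<and> hd xs = p \<and> last xs = q \<and> set xs \<subseteq> K \<and> successively (covers K) xs"

lemma successively_covers_sorted:
  assumes "successively (covers K) xs"
  shows "sorted_wrt (<) xs"
proof -
  have "successively (<) xs"
    using assms by (rule successively_mono) (simp add: covers_def)
  then show ?thesis by (simp add: successively_conv_sorted_wrt)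
qed

lemma saturated_from_to_sorted: "saturated_from_to K p q xs \<Longrightarrow> sorted_wrt (<) xs"
  unfolding saturated_from_to_def using successively_covers_sorted by blast

lemma saturated_from_to_between:
  assumes "saturated_from_to K p q xs" "x \<in> set xs"
  shows "p \<le> x" "x \<le> q"
proof -
  have s: "sorted_wrt (<) xs" using assms(1) by (rule saturated_from_to_sorted)
  have ne: "xs \<noteq> []" "hd xs = p" "last xs = q" using assms(1) by (auto simp: saturated_from_to_def)
  from ne s assms(2) show "p \<le> x" by (cases xs) auto
  from ne(1) obtain ys z where "xs = ys @ [z]" by (metis rev_exhaust)
  then show "x \<le> q" using ne s assms(2) by (auto simp: sorted_wrt_append)
qed

lemma saturated_from_to_le:
  assumes "saturated_from_to K p q xs"
  shows "p \<le> q"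
  using saturated_from_to_between(1)[OF assms, of q] assms
  by (auto simp: saturated_from_to_def)

text \<open>An element outside the chain but comparable to all of it would lie strictly between two
  neighbours, which a cover forbids.\<close>

lemma mem_saturated_if_comparable:
  assumes "successively (covers K) xs" "xs \<noteq> []" "z \<in> K" "hd xs \<le> z" "z \<le> last xs"
    "\<forall>x\<in>set xs. x \<le> z \<or> z \<le> x"
  shows "z \<in> set xs"
  using assms
proof (induction xs rule: induct_list012)
  case (3 x y zs)
  show ?case
  proof (cases "y \<le> z")
    case True
    then show ?thesis using 3 by auto
  next
    case False
    then have "z < y" using 3(8) by (auto simp: le_less)
    moreover have "\<not> (x < z \<and> z < y)" using 3(3) 3(5) by (auto simp: covers_def)
    ultimately show ?thesis using 3(6) by auto
  qed
qed auto

text \<open>This trades maximality, a statement about all chains of the interval, for a local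
  condition on neighbouring entries. Intervals are convex, so anything between two neighbours is
  again in the interval.\<close>

lemma maximal_chain_list_interval_iff:
  assumes "p \<in> K" "q \<in> K" "p \<le> q"
  shows "maximal_chain_list (interval K p q) xs \<longleftrightarrow> saturated_from_to K p q xs"
proof
  assume xs: "saturated_from_to K p q xs"
  then have s: "sorted_wrt (<) xs" by (rule saturated_from_to_sorted)
  have tot: "x \<le> y \<or> y \<le> x" if "x \<in> set xs" "y \<in> set xs" for x y
    using s that by (induction xs) (auto simp: le_less)
  have sub: "set xs \<subseteq> interval K p q"
    using saturated_from_to_between[OF xs] xs by (auto simp: interval_def saturated_from_to_def)
  have "C \<subseteq> set xs" if "pred_on.chain (interval K p q) (<) C" "set xs \<subseteq> C" for C
  proof
    fix z assume "z \<in> C"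
    then have "z \<in> interval K p q" "\<forall>x\<in>set xs. x \<le> z \<or> z \<le> x"
      using that by (auto simp: chain_iff)
    then show "z \<in> set xs"
      using xs mem_saturated_if_comparable[of K xs z]
      by (auto simp: interval_def saturated_from_to_def)
  qed
  moreover have "pred_on.chain (interval K p q) (<) (set xs)"
    using sub tot by (simp add: chain_iff)
  ultimately show "maximal_chain_list (interval K p q) xs"
    using s unfolding maximal_chain_list_def pred_on.maxchain_def by blast
next
  assume xs: "maximal_chain_list (interval K p q) xs"
  then have s: "sorted_wrt (<) xs" and "pred_on.chain (interval K p q) (<) (set xs)"
    by (simp_all add: maximal_chain_list_def pred_on.maxchain_def)
  then have sub: "set xs \<subseteq> interval K p q"
    and tot: "\<forall>x\<in>set xs. \<forall>y\<in>set xs. x \<le> y \<or> y \<le> x"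
    unfolding chain_iff by blast+
  \<comment> \<open>This is the usable form of maximality. It is applied to the endpoints
    \<open>p\<close> and \<open>q\<close> and to a supposed element between two neighbours.\<close>
  have mem: "z \<in> set xs" if z: "z \<in> interval K p q" "\<forall>x\<in>set xs. x \<le> z \<or> z \<le> x" for z
  proof (rule ccontr)
    assume "z \<notin> set xs"
    moreover have "pred_on.chain (interval K p q) (<) (insert z (set xs))"
      using z sub tot by (auto simp: chain_iff)
    ultimately show False
      using xs unfolding maximal_chain_list_def pred_on.maxchain_def by blast
  qed
  have p: "p \<in> set xs" and q: "q \<in> set xs"
    using sub assms by (auto intro!: mem simp: interval_def)
  then have ne: "xs \<noteq> []" by auto
  have hd: "hd xs = p"
  proof -
    have "hd xs \<le> p" using s p by (cases xs) auto
    moreover have "p \<le> hd xs" using ne sub by (force simp: interval_def)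
    ultimately show ?thesis by simp
  qed
  have last: "last xs = q"
  proof -
    obtain ys z where "xs = ys @ [z]" using ne by (metis rev_exhaust)
    then have "q \<le> last xs" using s q by (auto simp: sorted_wrt_append)
    moreover have "last xs \<le> q" using ne sub by (force simp: interval_def)
    ultimately show ?thesis by simp
  qed
  have "successively (covers K) xs"
  proof (rule successivelyI_split)
    fix as x y bs assume split: "xs = as @ x # y # bs"
    have "\<not> (x < r \<and> r < y)" if "r \<in> K" for r
    proof
      assume r: "x < r \<and> r < y"
      have ord: "\<forall>a\<in>set as. a < x" "\<forall>b\<in>set bs. y < b"
        using s unfolding split by (auto simp: sorted_wrt_append)
      then have ord': "\<forall>a\<in>set as. a < r" "\<forall>b\<in>set bs. r < b"
        using r by (meson order.strict_trans)+
      have "r \<in> interval K p q"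
        using r that sub unfolding split by (auto simp: interval_def)
      moreover have "\<forall>a\<in>set xs. a \<le> r \<or> r \<le> a"
        using r ord' unfolding split by (auto intro: less_imp_le)
      ultimately have "r \<in> set xs" by (rule mem)
      then show False using r ord' unfolding split by auto
    qed
    then show "covers K x y"
      using s sub unfolding split covers_def by (auto simp: sorted_wrt_append interval_def)
  qed
  then show "saturated_from_to K p q xs"
    using ne hd last sub by (auto simp: saturated_from_to_def interval_def)
qed

lemma saturated_from_to_segment:
  assumes "saturated_from_to K p q (as @ u # bs @ v # cs)"
  shows "saturated_from_to K u v (u # bs @ [v])"
  using assms
  by (auto simp: saturated_from_to_def successively_append_iff successively_Cons hd_append
      split: if_splits)

text \<open>Each cover of the new list lies either in an outer piece of the old chain or in the new
  segment, since \<open>u\<close> and \<open>v\<close> belong to both.\<close>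

lemma saturated_from_to_replace:
  assumes "saturated_from_to K p q (as @ u # bs @ v # cs)" "saturated_from_to K u v (u # bs' @ [v])"
  shows "saturated_from_to K p q (as @ u # bs' @ v # cs)"
proof -
  have "successively (covers K) (as @ u # bs' @ v # cs)"
    using assms unfolding saturated_from_to_def
    by (auto simp: successively_append_iff successively_Cons hd_append split: if_splits)
  then show ?thesis
    using assms by (auto simp: saturated_from_to_def hd_append split: if_splits)
qed

text \<open>
  \<open>u\<close> is the last element before \<open>xs\<close> and \<open>ys\<close> part for the first time, and \<open>v\<close> the first element of
  \<open>xs\<close> at which they meet again.
\<close>

lemma saturated_from_to_first_difference:
  assumes "saturated_from_to K p q xs" "saturated_from_to K p q ys" "xs \<noteq> ys"
  shows "\<exists>as u bs v cs bs' cs'. xs = as @ u # bs @ v # cs \<and> ys = as @ u # bs' @ v # cs' \<and>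
    bs \<noteq> [] \<and> set bs \<inter> set ys = {}"
  using assms
proof (induction xs arbitrary: p ys)
  case Nil
  then show ?case by (simp add: saturated_from_to_def)
next
  case (Cons x xs)
  then obtain ys' where ys: "ys = x # ys'" by (cases ys) (auto simp: saturated_from_to_def)
  have sx: "sorted_wrt (<) (x # xs)" and sy: "sorted_wrt (<) (x # ys')"
    using Cons.prems(1,2) saturated_from_to_sorted unfolding ys by blast+
  have last: "last (x # xs) = last (x # ys')"
    using Cons.prems(1,2) unfolding ys by (auto simp: saturated_from_to_def)
  have "xs \<noteq> ys'" using Cons.prems(3) ys by simp
  have ne: "xs \<noteq> []" "ys' \<noteq> []"
    using last sx sy \<open>xs \<noteq> ys'\<close> by (auto split: if_splits)
  show ?case
  \<comment> \<open>If the second elements agree, \<open>x\<close> joins the common prefix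
    \<open>as\<close>; otherwise the chains part right after \<open>x\<close>, and \<open>u\<close>
    is \<open>x\<close>.\<close>
  proof (cases "hd xs = hd ys'")
    case True
    have "saturated_from_to K (hd xs) q xs" "saturated_from_to K (hd xs) q ys'"
      using Cons.prems(1,2) ne True unfolding ys
      by (auto simp: saturated_from_to_def successively_Cons)
    then obtain as u bs v cs bs' cs' where d:
      "xs = as @ u # bs @ v # cs" "ys' = as @ u # bs' @ v # cs'" "bs \<noteq> []" "set bs \<inter> set ys' = {}"
      using Cons.IH[of "hd xs" ys'] \<open>xs \<noteq> ys'\<close> by blast
    have "x # xs = (x # as) @ u # bs @ v # cs" "ys = (x # as) @ u # bs' @ v # cs'"
      using d(1,2) ys by simp_all
    moreover have "x \<notin> set bs" using sx d(1) by auto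
    then have "set bs \<inter> set ys = {}" using d(4) ys by simp
    ultimately show ?thesis using d(3) by blast
  next
    case False
    \<comment> \<open>The chains meet again at their common last element at the latest;
      \<open>v\<close> is the first meeting point along \<open>xs\<close>.\<close>
    have "\<exists>v\<in>set xs. v \<in> set ys'" using last ne by (metis last_ConsR last_in_set)
    then obtain bs v cs where xs: "xs = bs @ v # cs" "v \<in> set ys'" "\<forall>b\<in>set bs. b \<notin> set ys'"
      using split_list_first_prop[of xs "\<lambda>v. v \<in> set ys'"] by blast
    obtain bs' cs' where ys': "ys' = bs' @ v # cs'" using xs(2) by (meson split_list)
    \<comment> \<open>Otherwise \<open>v\<close> covers \<open>x\<close>, while \<open>ys\<close>
      has an element strictly between them because its second element differs from
      \<open>v\<close>.\<close>
    have "bs \<noteq> []"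
    proof
      assume "bs = []"
      then have cov: "covers K x v" using Cons.prems(1) xs(1) by (auto simp: saturated_from_to_def)
      have "bs' \<noteq> []" using False xs(1) ys' \<open>bs = []\<close> by auto
      then obtain b bs'' where "bs' = b # bs''" by (cases bs') auto
      then have "x < b" "b < v" "b \<in> K" using sy Cons.prems(2) unfolding ys ys'
        by (auto simp: saturated_from_to_def)
      then show False using cov by (auto simp: covers_def)
    qed
    moreover have "x # xs = [] @ x # bs @ v # cs" "ys = [] @ x # bs' @ v # cs'"
      using xs(1) ys ys' by simp_all
    moreover have "x \<notin> set bs" using sx xs(1) by auto
    then have "set bs \<inter> set ys = {}" using xs(3) ys by auto
    ultimately show ?thesis by blast
  qed
qed

section \<open>Jordan-Holder sequences and their lexicographic order\<close>

lemma JH_sequence_simps [simp]: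
  "JH_sequence lam [] = []"
  "JH_sequence lam [x] = []"
  "JH_sequence lam (x # y # zs) = lam x y # JH_sequence lam (y # zs)"
  by (simp_all add: JH_sequence_def)

text \<open>Labels sit on edges, so \<open>u\<close> is needed in both pieces: as the end of the
  edge into it and as the start of the edge out of it.\<close>

lemma JH_sequence_append:
  "JH_sequence lam (as @ u # bs) = JH_sequence lam (as @ [u]) @ JH_sequence lam (u # bs)"
  by (induction as rule: induct_list012) auto

lemma length_JH_sequence: "length (JH_sequence lam xs) = length xs - 1"
  by (simp add: JH_sequence_def)

lemma lex_precedes_irrefl: "\<not> lex_precedes as as"
  unfolding lex_precedes_def by (rule lexord_irreflexive) auto

lemma lex_precedes_trans: "lex_precedes as bs \<Longrightarrow> lex_precedes bs cs \<Longrightarrow> lex_precedes as cs"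
  unfolding lex_precedes_def by (rule lexord_trans) (auto simp: trans_def)

text \<open>The labels before \<open>u\<close> agree, so the middle blocks decide. Equal lengths
  exclude that one block precedes the other merely as a proper prefix, when the labels after
  \<open>v\<close> could matter.\<close>

lemma lex_precedes_JH_replace:
  assumes "lex_precedes (JH_sequence lam (u # bs @ [v])) (JH_sequence lam (u # bs' @ [v]))"
    "length bs = length bs'"
  shows "lex_precedes (JH_sequence lam (as @ u # bs @ v # cs))
    (JH_sequence lam (as @ u # bs' @ v # cs'))"
proof -
  have split: "JH_sequence lam (as @ u # bs @ v # cs) =
      JH_sequence lam (as @ [u]) @ JH_sequence lam (u # bs @ [v]) @ JH_sequence lam (v # cs)"
    for bs cs
    using JH_sequence_append[of lam as u "bs @ v # cs"] JH_sequence_append[of lam "u # bs" v cs]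
    by simp
  show ?thesis
    using assms unfolding split lex_precedes_def
    by (intro lexord_append_leftI lexord_sufI) (auto simp: length_JH_sequence)
qed

text \<open>As \<open><\<close> is transitive, a failure of increase already shows at two
  consecutive edges. Labels are partially ordered, so a descent is just the failure of
  \<open><\<close>.\<close>

lemma ex_descent_if_not_increasing:
  assumes "\<not> increasing_chain lam xs"
  shows "\<exists>as a e c cs. xs = as @ a # e # c # cs \<and> \<not> lam a e < lam e c"
  using assms
proof (induction xs rule: induct_list012)
  case (3 x y zs)
  show ?case
  proof (cases "increasing_chain lam (y # zs)")
    case True
    then obtain z zs' where "zs = z # zs'" "\<not> lam x y < lam y z"
      using 3(3) by (cases zs)
        (auto simp: increasing_chain_def sorted_wrt2 sorted_wrt1 simp del: sorted_wrt.simps)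
    then show ?thesis by (intro exI[of _ "[]"]) auto
  next
    case False
    then obtain as a e c cs where "y # zs = as @ a # e # c # cs" "\<not> lam a e < lam e c"
      using 3(2) by blast
    then show ?thesis by (intro exI[of _ "x # as"]) auto
  qed
qed (auto simp: increasing_chain_def)

section \<open>Facets of the order complex, and exchanges of maximal chains\<close>

lemma facets_order_complex:
  assumes "finite K"
  shows "facets (order_complex K) = set ` {xs. maximal_chain_list K xs}"
proof -
  have fin: "finite C" if "pred_on.chain K (<) C" for C
    using that assms by (auto simp: chain_iff intro: finite_subset)
  then have "facets (order_complex K) = {C. pred_on.maxchain K (<) C}"
    unfolding facets_def order_complex_def pred_on.maxchain_def by blast
  moreover have "\<exists>xs. maximal_chain_list K xs \<and> C = set xs" if C: "pred_on.maxchain K (<) C" for C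
  proof -
    have "pred_on.chain K (<) C" using C by (simp add: pred_on.maxchain_def)
    then obtain xs where "sorted_wrt (<) xs" "set xs = C"
      using ex_sorted_list_of_finite_chain fin by blast
    then show ?thesis using C by (auto simp: maximal_chain_list_def)
  qed
  ultimately show ?thesis unfolding maximal_chain_list_def by blast
qed

text \<open>In a finite poset every element lies above a minimal and below a maximal one; uniqueness
  makes these the two ends. Results on chains in intervals thus apply to the whole poset.\<close>

lemma graded_poset_eq_interval:
  assumes "graded_poset K"
  obtains p q where "p \<in> K" "q \<in> K" "p \<le> q" "K = interval K p q"
proof -
  have fin: "finite K" and "\<exists>!m. is_minimal K m" "\<exists>!m. is_maximal K m"
    using assms by (simp_all add: graded_poset_def)
  then obtain p q where p: "is_minimal K p" "\<And>x. is_minimal K x \<Longrightarrow> x = p"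
    and q: "is_maximal K q" "\<And>x. is_maximal K x \<Longrightarrow> x = q"
    by (elim ex1E) blast
  have pq: "p \<in> K" "q \<in> K" using p(1) q(1) by (simp_all add: is_minimal_def is_maximal_def)
  have le: "p \<le> x" if x: "x \<in> K" for x
  proof -
    obtain m where "m \<in> K" "m \<le> x" "\<forall>y\<in>K. y \<le> m \<longrightarrow> m = y"
      using finite_has_minimal2[OF fin x] by blast
    moreover from this have "is_minimal K m" unfolding is_minimal_def le_less by blast
    ultimately show ?thesis using p(2)[of m] by simp
  qed
  have ge: "x \<le> q" if x: "x \<in> K" for x
  proof -
    obtain m where "m \<in> K" "x \<le> m" "\<forall>y\<in>K. m \<le> y \<longrightarrow> m = y"
      using finite_has_maximal2[OF fin x] by blast
    moreover from this have "is_maximal K m" unfolding is_maximal_def le_less by blast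
    ultimately show ?thesis using q(2)[of m] by simp
  qed
  have "K = interval K p q" using le ge unfolding interval_def by blast
  then show thesis by (rule that[OF pq le[OF pq(2)]])
qed

text \<open>This exchange carries the shelling. The hypothesis \<open>nless\<close> says only that
  \<open>xs\<close> does not precede \<open>ys\<close>, because incomparable sequences may be listed
  in either order.\<close>

lemma ex_adjacent_earlier_chain:
  assumes K: "L_labeling K lam"
    and xs: "maximal_chain_list K xs" and ys: "maximal_chain_list K ys" and "xs \<noteq> ys"
    and nless: "\<not> lex_precedes (JH_sequence lam xs) (JH_sequence lam ys)"
  shows "\<exists>zs e. maximal_chain_list K zs \<and> lex_precedes (JH_sequence lam zs) (JH_sequence lam xs) \<and>
    e \<in> set xs - set ys \<and> set zs \<inter> set xs = set xs - {e}"
proof -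
  have "graded_poset K" using K by (simp add: L_labeling_def)
  then obtain p q where pq: "p \<in> K" "q \<in> K" "p \<le> q" "K = interval K p q"
    by (rule graded_poset_eq_interval)
  have mcl: "maximal_chain_list K zs \<longleftrightarrow> saturated_from_to K p q zs" for zs
    using maximal_chain_list_interval_iff[OF pq(1-3)] pq(4) by simp
  have len: "length zs = length xs" if "saturated_from_to K p q zs" for zs
  proof -
    have "card (set zs) = card (set xs)"
      using \<open>graded_poset K\<close> that xs mcl unfolding graded_poset_def maximal_chain_list_def by blast
    moreover have "distinct zs" "distinct xs"
      using that xs saturated_from_to_sorted by (auto simp: mcl intro!: sorted_wrt_less_distinct)
    ultimately show ?thesis by (simp add: distinct_card)
  qed
  obtain as u bs v cs bs' cs' where
    xs_eq: "xs = as @ u # bs @ v # cs" and ys_eq: "ys = as @ u # bs' @ v # cs'"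
    and bs: "bs \<noteq> []" "set bs \<inter> set ys = {}"
    using saturated_from_to_first_difference[of K p q xs ys] xs ys \<open>xs \<noteq> ys\<close> unfolding mcl by blast
  have sat: "saturated_from_to K p q (as @ u # bs @ v # cs)" using xs unfolding mcl xs_eq .
  have seg: "saturated_from_to K u v (u # bs @ [v])" "saturated_from_to K u v (u # bs' @ [v])"
    using xs ys saturated_from_to_segment unfolding mcl xs_eq ys_eq by blast+
  have uv: "u \<in> K" "v \<in> K" "u \<le> v"
    using seg(1) saturated_from_to_le[OF seg(1)] by (auto simp: saturated_from_to_def)
  \<comment> \<open>Splicing \<open>bs'\<close> into \<open>xs\<close> gives another maximal chain
    of \<open>K\<close>, which has the size of \<open>xs\<close> by gradedness.\<close>
  have "length bs' = length bs"
    using len[OF saturated_from_to_replace[OF sat seg(2)]] by (simp add: xs_eq)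
  have "bs \<noteq> bs'"
    using bs unfolding ys_eq by (cases bs) auto
  have "u < v"
    using saturated_from_to_sorted[OF seg(1)] by auto
  \<comment> \<open>Otherwise the lexicographic condition on the interval from \<open>u\<close> to
    \<open>v\<close> would make \<open>xs\<close> precede \<open>ys\<close>.\<close>
  have "\<not> increasing_chain lam (u # bs @ [v])"
  proof
    assume "increasing_chain lam (u # bs @ [v])"
    then have "lex_precedes (JH_sequence lam (u # bs @ [v])) (JH_sequence lam (u # bs' @ [v]))"
      using K uv \<open>u < v\<close> seg \<open>bs \<noteq> bs'\<close> maximal_chain_list_interval_iff[OF uv]
      unfolding L_labeling_def by (metis append_same_eq list.inject)
    then show False
      using lex_precedes_JH_replace[of lam u bs v bs' as cs cs'] nless \<open>length bs' = length bs\<close>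
      unfolding xs_eq ys_eq by simp
  qed
  then obtain ds a e c es where d: "u # bs @ [v] = ds @ a # e # c # es" "\<not> lam a e < lam e c"
    using ex_descent_if_not_increasing by blast
  \<comment> \<open>\<open>e\<close> has a neighbour on each side within the segment, so it is
    neither \<open>u\<close> nor \<open>v\<close>; hence it is missing from
    \<open>ys\<close>.\<close>
  have "e \<in> set bs"
  proof -
    have "e \<in> set (butlast (tl (u # bs @ [v])))"
      unfolding d(1) by (cases ds) (auto simp: butlast_append)
    then show ?thesis by simp
  qed
  obtain A B where xs_eq2: "xs = A @ a # [e] @ c # B"
  proof
    have "xs = as @ (u # bs @ [v]) @ cs" by (simp add: xs_eq)
    then show "xs = (as @ ds) @ a # [e] @ c # (es @ cs)" unfolding d(1) by simp
  qed
  have sat2: "saturated_from_to K p q (A @ a # [e] @ c # B)" using xs unfolding mcl xs_eq2 .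
  have seg2: "saturated_from_to K a c (a # [e] @ [c])" by (rule saturated_from_to_segment[OF sat2])
  have ac: "a \<in> K" "c \<in> K" "a \<le> c" "a < c"
    using seg2 saturated_from_to_le[OF seg2] saturated_from_to_sorted[OF seg2]
    by (auto simp: saturated_from_to_def)
  obtain ws where ws: "saturated_from_to K a c ws" "increasing_chain lam ws"
    using K ac maximal_chain_list_interval_iff[OF ac(1-3)] unfolding L_labeling_def by metis
  \<comment> \<open>The segment through \<open>e\<close> has a descent there, so the increasing
    chain \<open>ws\<close> differs from it and precedes it.\<close>
  have "ws \<noteq> a # [e] @ [c]"
    using ws(2) d(2) by (auto simp: increasing_chain_def)
  then have lex: "lex_precedes (JH_sequence lam ws) (JH_sequence lam (a # [e] @ [c]))"
    using K ac ws seg2 maximal_chain_list_interval_iff[OF ac(1-3)] unfolding L_labeling_def by metis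
  obtain ws' where ws': "ws = a # ws' @ [c]"
  proof (cases ws)
    case (Cons w ws'')
    then have "ws'' \<noteq> []" using ws(1) ac(4) by (auto simp: saturated_from_to_def)
    then obtain l c' where "ws'' = l @ [c']" by (metis rev_exhaust)
    then show ?thesis using that Cons ws(1) by (auto simp: saturated_from_to_def)
  qed (use ws(1) in \<open>simp add: saturated_from_to_def\<close>)
  have sat3: "saturated_from_to K p q (A @ a # ws' @ c # B)"
    using saturated_from_to_replace[OF sat2] ws(1) unfolding ws' by blast
  \<comment> \<open>Gradedness again: replacing \<open>e\<close> by \<open>ws'\<close> cannot change
    the size of the chain.\<close>
  have "length ws' = 1" using len[OF sat3] by (simp add: xs_eq2)
  then obtain z where z: "ws' = [z]" by (metis length_0_conv length_Suc_conv One_nat_def)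
  define zs where "zs = A @ a # [z] @ c # B"
  have "z \<noteq> e" using \<open>ws \<noteq> a # [e] @ [c]\<close> unfolding ws' z by simp
  have "maximal_chain_list K zs" using sat3 unfolding mcl zs_def z .
  moreover have "lex_precedes (JH_sequence lam zs) (JH_sequence lam xs)"
    using lex_precedes_JH_replace[of lam a "[z]" c "[e]" A B B] lex unfolding ws' z zs_def xs_eq2 by simp
  moreover have "e \<in> set xs - set ys" using \<open>e \<in> set bs\<close> bs(2) by (auto simp: xs_eq)
  \<comment> \<open>\<open>z\<close> lies strictly between \<open>a\<close> and \<open>c\<close>,
    where \<open>xs\<close> has only \<open>e\<close>, so \<open>z\<close> is not in
    \<open>xs\<close>.\<close>
  moreover have "set zs \<inter> set xs = set xs - {e}"
    using saturated_from_to_sorted[OF sat2] saturated_from_to_sorted[OF sat3] \<open>z \<noteq> e\<close>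
    unfolding zs_def xs_eq2 z by (auto simp: sorted_wrt_append)
  ultimately show ?thesis by blast
qed

section \<open>Shelling the order complex of a graded poset\<close>

lemma maximal_proper_faces_eq: "maximal_proper_faces F = (\<lambda>x. F - {x}) ` F"
proof (intro equalityI subsetI)
  fix G assume G: "G \<in> maximal_proper_faces F"
  then obtain x where x: "x \<in> F" "x \<notin> G" by (auto simp: maximal_proper_faces_def)
  then have "G \<subseteq> F - {x}" "F - {x} \<subset> F" using G by (auto simp: maximal_proper_faces_def)
  then have "G = F - {x}" using G by (auto simp: maximal_proper_faces_def)
  then show "G \<in> (\<lambda>x. F - {x}) ` F" using x by blast
qed (auto simp: maximal_proper_faces_def)

lemma abstract_simplicial_complex_order_complex:
  assumes "countable K"
  shows "abstract_simplicial_complex (order_complex K)"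
proof -
  have "\<Union>(order_complex K) \<subseteq> K" by (auto simp: order_complex_def chain_iff)
  then have "countable (\<Union>(order_complex K))" using assms by (rule countable_subset)
  moreover have "G \<in> order_complex K" if "F \<in> order_complex K" "G \<subseteq> F" for F G
    using that finite_subset[of G F] unfolding order_complex_def chain_iff by blast
  moreover have "\<forall>F\<in>order_complex K. finite F" by (simp add: order_complex_def)
  ultimately show ?thesis unfolding abstract_simplicial_complex_def by blast
qed

lemma finite_order_complex: "finite K \<Longrightarrow> finite (order_complex K)"
  by (rule finite_subset[of _ "Pow K"]) (auto simp: order_complex_def chain_iff)

theorem shellable_order_complex_if_L_labeling:
  assumes K: "L_labeling K lam"
  shows "shellable (order_complex K)"
proof -
  have graded: "graded_poset K" and fin: "finite K"
    using K by (auto simp: L_labeling_def graded_poset_def)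
  define M where "M = {xs. maximal_chain_list K xs}"
  define R where "R xs ys \<longleftrightarrow> lex_precedes (JH_sequence lam xs) (JH_sequence lam ys)" for xs ys
  have inj: "inj_on set M"
    by (rule inj_onI) (auto simp: M_def maximal_chain_list_def intro: sorted_wrt_less_set_inj)
  have facets: "facets (order_complex K) = set ` M"
    using facets_order_complex[OF fin] by (simp add: M_def)
  have "finite (facets (order_complex K))"
    using finite_order_complex[OF fin] by (simp add: facets_def)
  then have "finite M" using inj unfolding facets by (rule finite_imageD)
  moreover have "asymp_on M R" "transp_on M R"
    unfolding R_def asymp_on_def transp_on_def
    using lex_precedes_trans lex_precedes_irrefl by blast+
  ultimately obtain Xs where Xs: "distinct Xs" "set Xs = M" "sorted_wrt (\<lambda>x y. \<not> R y x) Xs"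
    using ex_linear_extension_list by blast
  define Fs where "Fs = map set Xs"
  have "\<exists>S. S \<noteq> {} \<and> S \<subseteq> maximal_proper_faces (Fs ! j) \<and>
      generated_complex {Fs ! j} \<inter> generated_complex (set (take j Fs)) = generated_complex S"
    if j: "0 < j" "j < length Fs" for j
  proof -
    have jl: "j < length Xs" using j by (simp add: Fs_def)
    \<comment> \<open>Only those faces of codimension one are taken that are exactly the
      intersection with an earlier facet. They lie in the earlier complex by construction;
      \<open>key\<close> gives the converse inclusion.\<close>
    define S where "S = {Fs ! j - {x} | x. x \<in> Fs ! j \<and> (\<exists>k<j. Fs ! k \<inter> Fs ! j = Fs ! j - {x})}"
    have key: "\<exists>G\<in>S. Fs ! i \<inter> Fs ! j \<subseteq> G" if "i < j" for i
    proof -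
      have "maximal_chain_list K (Xs ! j)" "maximal_chain_list K (Xs ! i)"
        using Xs(2) nth_mem[of j Xs] nth_mem[of i Xs] jl that by (simp_all add: M_def)
      moreover have "Xs ! j \<noteq> Xs ! i" using Xs(1) jl that by (simp add: nth_eq_iff_index_eq)
      moreover have "\<not> R (Xs ! j) (Xs ! i)"
        using Xs(3) jl that by (auto simp: sorted_wrt_iff_nth_less)
      ultimately obtain zs e where zs: "zs \<in> M" "R zs (Xs ! j)"
        "e \<in> set (Xs ! j) - set (Xs ! i)" "set zs \<inter> set (Xs ! j) = set (Xs ! j) - {e}"
        using ex_adjacent_earlier_chain[OF K, of "Xs ! j" "Xs ! i"] unfolding R_def M_def by blast
      obtain k where k: "k < length Xs" "zs = Xs ! k" using zs(1) Xs(2) by (metis in_set_conv_nth)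
      \<comment> \<open>\<open>zs\<close> precedes \<open>Xs ! j\<close> lexicographically, so the
        list cannot place it later; irreflexivity excludes the same position.\<close>
      have "\<not> j < k" using zs(2) k Xs(3) by (auto simp: sorted_wrt_iff_nth_less)
      moreover have "j \<noteq> k" using zs(2) k lex_precedes_irrefl by (auto simp: R_def)
      ultimately have "k < j" by simp
      have "e \<in> Fs ! j" "Fs ! k \<inter> Fs ! j = Fs ! j - {e}"
        using zs k jl by (simp_all add: Fs_def)
      then have "Fs ! j - {e} \<in> S"
        using \<open>k < j\<close> unfolding S_def by blast
      moreover have "Fs ! i \<inter> Fs ! j \<subseteq> Fs ! j - {e}"
        using zs(3) jl that by (auto simp: Fs_def)
      ultimately show ?thesis by blast
    qed
    have "S \<noteq> {}" using key[of 0] j by blast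
    moreover have "S \<subseteq> maximal_proper_faces (Fs ! j)"
      unfolding S_def maximal_proper_faces_eq by auto
    moreover have "generated_complex {Fs ! j} \<inter> generated_complex (set (take j Fs)) = generated_complex S"
    proof (intro equalityI subsetI)
      fix X assume X: "X \<in> generated_complex {Fs ! j} \<inter> generated_complex (set (take j Fs))"
      then obtain i where "i < j" "X \<subseteq> Fs ! i"
        using j by (auto simp: generated_complex_def in_set_conv_nth)
      moreover have "X \<subseteq> Fs ! j" using X by (auto simp: generated_complex_def)
      ultimately show "X \<in> generated_complex S"
        using key[of i] unfolding generated_complex_def by blast
    next
      fix X assume "X \<in> generated_complex S"
      then obtain x k where "k < j" "Fs ! k \<inter> Fs ! j = Fs ! j - {x}" "X \<subseteq> Fs ! j - {x}"
        unfolding S_def generated_complex_def by blast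
      moreover from \<open>k < j\<close> have "Fs ! k \<in> set (take j Fs)"
        using j by (auto simp: in_set_conv_nth)
      ultimately show "X \<in> generated_complex {Fs ! j} \<inter> generated_complex (set (take j Fs))"
        unfolding generated_complex_def by blast
    qed
    ultimately show ?thesis by blast
  qed
  moreover have "distinct Fs" "set Fs = facets (order_complex K)"
    using Xs inj facets by (auto simp: Fs_def distinct_map)
  moreover have "pure_complex (order_complex K)"
    using graded by (auto simp: pure_complex_def facets M_def maximal_chain_list_def graded_poset_def)
  moreover have "abstract_simplicial_complex (order_complex K)"
    using fin by (intro abstract_simplicial_complex_order_complex countable_finite)
  moreover have "finite (order_complex K)" using fin by (rule finite_order_complex)
  ultimately show ?thesis unfolding shellable_def by blast
qed

section \<open>Exhaustion by intervals from the minimum\<close>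

lemma full_subcomplex_order_complex:
  assumes "countable P" "K \<subseteq> P"
  shows "full_subcomplex (order_complex K) (order_complex P)"
  using assms abstract_simplicial_complex_order_complex[OF countable_subset[OF assms(2,1)]]
  unfolding full_subcomplex_def by (auto simp: order_complex_def chain_iff)

text \<open>In an infinite poset a unique minimal element need not be least. Here the saturated
  chains from it to every \<open>p\<close> make it so.\<close>

lemma N_graded_zero_hat:
  assumes "N_graded P"
  shows "zero_hat P \<in> P" "p \<in> P \<Longrightarrow> zero_hat P \<le> p"
proof -
  show "zero_hat P \<in> P"
    using assms theI'[of "is_minimal P"] unfolding N_graded_def zero_hat_def is_minimal_def by blast
  assume "p \<in> P"
  then obtain xs where "saturated_from_to P (zero_hat P) p xs"
    using assms unfolding N_graded_def saturated_from_to_def by blast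
  then show "zero_hat P \<le> p" by (rule saturated_from_to_le)
qed

theorem theoremB:
  fixes P :: "'a::order set"
  assumes "lex_nested_shellable TYPE('q::order) P"
  shows "nested_shellable (order_complex P)"
proof -
  have fin: "finite (interval P p q)" if "p \<in> P" "q \<in> P" for p q
    using assms that unfolding lex_nested_shellable_def interval_finite_def by blast
  have "N_graded P" using assms by (simp add: lex_nested_shellable_def)
  note zero = N_graded_zero_hat[OF this]
  have "\<exists>lam :: 'a \<Rightarrow> 'a \<Rightarrow> 'q. \<forall>p\<in>P. \<forall>q\<in>P. p \<le> q \<longrightarrow> L_labeling (interval P p q) lam"
    using assms unfolding lex_nested_shellable_def by (elim conjE)
  then obtain lam :: "'a \<Rightarrow> 'a \<Rightarrow> 'q" where
    lam: "\<forall>p\<in>P. \<forall>q\<in>P. p \<le> q \<longrightarrow> L_labeling (interval P p q) lam" ..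
  have "\<exists>(I :: nat set) c. (I = UNIV \<or> (\<exists>n. I = {..n})) \<and> strict_mono_on I c \<and> c ` I \<subseteq> P \<and>
      c 0 = zero_hat P \<and> (\<forall>p\<in>P. \<exists>i\<in>I. p \<le> c i)"
    using assms unfolding lex_nested_shellable_def by (elim conjE)
  then obtain I :: "nat set" and c where I: "I = UNIV \<or> (\<exists>n. I = {..n})"
    and c: "strict_mono_on I c" "c ` I \<subseteq> P" and cofinal: "\<forall>p\<in>P. \<exists>i\<in>I. p \<le> c i"
    by metis
  \<comment> \<open>The cofinal chain may be finite, with index set \<open>{..n}\<close>. Reindexing
    by \<open>min n\<close> repeats its last element forever and gives a sequence over all
    naturals.\<close>
  have "\<exists>d :: nat \<Rightarrow> nat. mono d \<and> range d = I"
    using I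
  proof
    assume "\<exists>n. I = {..n}"
    then obtain n where n: "I = {..n}" by blast
    have "x \<in> range (min n)" if "x \<le> n" for x
      using that by (intro range_eqI[of _ _ x]) simp
    then have "range (min n) = I" unfolding n by auto
    then show ?thesis by (intro exI[of _ "min n"]) (auto simp: mono_def)
  qed (auto intro!: exI[of _ id] simp: mono_def)
  then obtain d :: "nat \<Rightarrow> nat" where d: "mono d" "range d = I" by blast
  define b where "b n = c (d n)" for n
  have bP: "b n \<in> P" for n using c(2) d(2) by (auto simp: b_def)
  \<comment> \<open>Because of possible repetitions the sequence increases only weakly, which
    suffices for nested intervals.\<close>
  have bmono: "b n \<le> b (Suc n)" for n
  proof -
    have "d n \<le> d (Suc n)" "d n \<in> I" "d (Suc n) \<in> I" using d by (auto simp: mono_def)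
    then show ?thesis using c(1) unfolding b_def by (metis strict_mono_onD le_less)
  qed
  have bcof: "\<exists>n. p \<le> b n" if "p \<in> P" for p
    using cofinal that d(2) unfolding b_def by (metis imageE)
  define K where "K n = interval P (zero_hat P) (b n)" for n
  have KP: "K n \<subseteq> P" and Kmono: "K n \<subseteq> K (Suc n)" and Kfin: "finite (K n)" for n
    using bmono[of n] fin[OF zero(1) bP] by (auto simp: K_def interval_def intro: order_trans)
  have inK: "\<exists>n. p \<in> K n" if "p \<in> P" for p
    using bcof[OF that] zero(2) that by (auto simp: K_def interval_def)
  \<comment> \<open>The countable vertex set demanded of a simplicial complex comes from exhausting
    \<open>P\<close> by countably many finite intervals.\<close>
  have "countable (\<Union>n. K n)" using Kfin by (simp add: countable_finite)
  moreover have "P \<subseteq> (\<Union>n. K n)" using inK by blast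
  ultimately have count: "countable P" by (rule countable_subset[rotated])
  have "order_complex P \<subseteq> (\<Union>n. order_complex (K n))"
  proof
    fix C assume C: "C \<in> order_complex P"
    then have "finite C" "C \<subseteq> P" by (auto simp: order_complex_def chain_iff)
    \<comment> \<open>Faces are finite and the intervals nested, so one interval contains all
      vertices of \<open>C\<close>.\<close>
    have "\<exists>n. C \<subseteq> K n"
      using \<open>finite C\<close> \<open>C \<subseteq> P\<close>
    proof induction
      case (insert x C)
      then obtain n m where "C \<subseteq> K n" "x \<in> K m" using inK[of x] by blast
      moreover have "K n \<subseteq> K (max n m)" "K m \<subseteq> K (max n m)"
        using lift_Suc_mono_le[of K, OF Kmono] by simp_all
      ultimately show ?case by blast
    qed auto
    then show "C \<in> (\<Union>n. order_complex (K n))"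
      using C by (auto simp: order_complex_def chain_iff)
  qed
  moreover have "order_complex (K n) \<subseteq> order_complex P" for n
    using KP by (auto simp: order_complex_def chain_iff)
  ultimately have "(\<Union>n. order_complex (K n)) = order_complex P" by blast
  moreover have "order_complex (K n) \<subseteq> order_complex (K (Suc n))" for n
    using Kmono by (auto simp: order_complex_def chain_iff)
  moreover have "shellable (order_complex (K n))" for n
    unfolding K_def using lam zero bP
    by (intro shellable_order_complex_if_L_labeling[of _ lam]) blast
  ultimately show ?thesis
    unfolding nested_shellable_def
    using abstract_simplicial_complex_order_complex[OF count]
      full_subcomplex_order_complex[OF count KP] finite_order_complex[OF Kfin]
    by (intro conjI exI[of _ "\<lambda>n. order_complex (K n)"] allI)
qed

end
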